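(* Let $T\ge 1$ be an integer, $0<\alpha<1$, $0<\rho<1$, $0<\lambda\le1$ and $\sigma\ge 0$. Consider the problem of maximizing the normalized secondary throughput $\mathcal W_S(\underline\kappa)$ over all policies $\underline\kappa=(\kappa_0,\dots,\kappa_T)\in[0,1]^{T+1}$ subject to the constraint $\mathcal J_P^{\rm fp}(\underline\kappa)-\mathcal J_P^{\rm fp}(\underline 0)\le\sigma$ on the increase of the primary packet failure probability. Then for every optimal policy $\widehat{\underline\kappa}$ of this problem there exist integers $N_1,N_0\ge 0$ with $N_1+1+N_0=T+1$ and a number $\kappa_{N_1}\in[0,1]$ such that $\widehat\kappa_\theta=1$ for $0\le\theta<N_1$, $\widehat\kappa_{N_1}=\kappa_{N_1}$, and $\widehat\kappa_\theta=0$ for $N_1<\theta\le T$.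
   Context: A primary source transmits each packet at most $T$ times; in a slot in which no retransmission is scheduled it sends a fresh packet with probability $\alpha$. State $0$ means the primary source is idle; state $\theta\in\{1,\dots,T\}$ means that it is performing the $\theta$-th transmission of a packet. A policy of the secondary source is a vector $\underline\kappa=(\kappa_0,\dots,\kappa_T)\in[0,1]^{T+1}$, where $\kappa_\theta$ is the probability that the secondary source transmits in state $\theta$. The failure probability of the primary transmission in state $\theta\ge1$ is $\rho_\theta=\rho+(1-\rho)\lambda\kappa_\theta$. The failure probability at the secondary receiver does not depend on the primary's activity, and the secondary throughput is normalized by the corresponding success probability. The primary packet failure probability (all $T$ transmissions fail) and the normalized long-run throughput of the secondary source (the stationary fraction of slots in which it transmits) are $$\mathcal J_P^{\rm fp}(\underline\kappa)=\prod_{t=1}^{T}\rho_t,\qquad \mathcal W_S(\underline\kappa)=\frac{(1-\alpha)\kappa_0+\alpha\sum_{t=1}^{T}\kappa_t\prod_{i=1}^{t-1}\rho_i}{1+\alpha\sum_{t=1}^{T-1}\prod_{i=1}^{t}\rho_i}.$$ Empty products equal $1$, empty sums equal $0$. $\underline 0$ is the all-zero policy. *)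

theory Defs
  imports Complex_Main "HOL-Library.FuncSet"
begin

text \<open>A policy is a function \<^term>\<open>\<kappa> :: nat \<Rightarrow> real\<close> of which only the values at the states
  \<open>0, \<dots>, T\<close> matter; state \<open>0\<close> is the idle state of the primary source and state \<open>\<theta> \<ge> 1\<close>
  its \<open>\<theta>\<close>-th transmission of a packet.\<close>

definition policies :: "nat \<Rightarrow> (nat \<Rightarrow> real) set" where
  "policies T = {0..T} \<rightarrow> {0..1}"

definition fail_prob :: "real \<Rightarrow> real \<Rightarrow> (nat \<Rightarrow> real) \<Rightarrow> nat \<Rightarrow> real" where
  "fail_prob \<rho> lam \<kappa> \<theta> = \<rho> + (1 - \<rho>) * lam * \<kappa> \<theta>"

definition packet_fail_prob :: "nat \<Rightarrow> real \<Rightarrow> real \<Rightarrow> (nat \<Rightarrow> real) \<Rightarrow> real" where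
  "packet_fail_prob T \<rho> lam \<kappa> = (\<Prod>t=1..T. fail_prob \<rho> lam \<kappa> t)"

text \<open>The stationary fraction of slots in which the secondary source transmits. Up to the common
  normalization, the stationary weight of state \<open>0\<close> is \<open>1 - \<alpha>\<close> and that of state \<open>t \<ge> 1\<close> is
  \<open>\<alpha>\<close> times the probability that the first \<open>t - 1\<close> transmissions fail; the denominator
  is the sum of these weights.\<close>

definition sec_throughput ::
  "nat \<Rightarrow> real \<Rightarrow> real \<Rightarrow> real \<Rightarrow> (nat \<Rightarrow> real) \<Rightarrow> real" where
  "sec_throughput T \<alpha> \<rho> lam \<kappa> =
     ((1 - \<alpha>) * \<kappa> 0 + \<alpha> * (\<Sum>t=1..T. \<kappa> t * (\<Prod>i=1..t - 1. fail_prob \<rho> lam \<kappa> i))) /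
     (1 + \<alpha> * (\<Sum>t=1..T - 1. \<Prod>i=1..t. fail_prob \<rho> lam \<kappa> i))"

definition feasible :: "nat \<Rightarrow> real \<Rightarrow> real \<Rightarrow> real \<Rightarrow> (nat \<Rightarrow> real) \<Rightarrow> bool" where
  "feasible T \<rho> lam \<sigma> \<kappa> \<longleftrightarrow>
     \<kappa> \<in> policies T \<and>
     packet_fail_prob T \<rho> lam \<kappa> - packet_fail_prob T \<rho> lam (\<lambda>_. 0) \<le> \<sigma>"

definition optimal_policy ::
  "nat \<Rightarrow> real \<Rightarrow> real \<Rightarrow> real \<Rightarrow> real \<Rightarrow> (nat \<Rightarrow> real) \<Rightarrow> bool" where
  "optimal_policy T \<alpha> \<rho> lam \<sigma> \<kappa> \<longleftrightarrow>
     is_arg_max (sec_throughput T \<alpha> \<rho> lam) (feasible T \<rho> lam \<sigma>) \<kappa>"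

end

(* With P_t the product of the first t failure probabilities, c = (1 - rho) lam and
   S = P_0 + ... + P_(T-1), the identity c kappa_t P_(t-1) = P_t - rho P_(t-1) turns the throughput
   into
     ((1 - alpha) kappa_0 + (alpha / c) ((1 - rho) S + P_T - 1)) / (1 - alpha + alpha S).
   It strictly increases with kappa_0 and, for fixed P_T < 1, with S, while the constraint
   involves P_T only. If kappa_i < 1 and 0 < kappa_(i+1) with 1 <= i < T, multiplying the i-th
   failure probability by some s > 1 and dividing the next one by s keeps P_T and raises S, as it
   only changes P_i. So an optimal policy admits no such i and has kappa_0 = 1, which forces
   the threshold form. *)

theory Submission
  imports Defs
begin

lemma packet_fail_prob_0 [simp]: "packet_fail_prob 0 \<rho> lam \<kappa> = 1"
  by (simp add: packet_fail_prob_def)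

lemma packet_fail_prob_Suc [simp]:
  "packet_fail_prob (Suc n) \<rho> lam \<kappa> = packet_fail_prob n \<rho> lam \<kappa> * fail_prob \<rho> lam \<kappa> (Suc n)"
  by (simp add: packet_fail_prob_def)

text \<open>Since \<open>(1 - \<rho>) * lam * \<kappa> t\<close> is the t-th failure probability
  minus \<open>\<rho>\<close>, each summand becomes P_t - \<rho> P_(t-1) = (P_t - P_(t-1)) + (1 -
  \<rho>) P_(t-1); the bracketed differences telescope to P_T - P_0 with P_0 = 1.\<close>

lemma sum_secondary_weights:
  "(1 - \<rho>) * lam * (\<Sum>t=1..T. \<kappa> t * packet_fail_prob (t - 1) \<rho> lam \<kappa>) =
     (1 - \<rho>) * (\<Sum>t<T. packet_fail_prob t \<rho> lam \<kappa>) + packet_fail_prob T \<rho> lam \<kappa> - 1"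
proof (induction T)
  case (Suc T)
  then show ?case
    by (simp add: distrib_left fail_prob_def) (simp add: algebra_simps)
qed simp

lemma sec_throughput_eq:
  fixes \<kappa> :: "nat \<Rightarrow> real"
  assumes "T \<ge> 1" "(1 - \<rho>) * lam \<noteq> 0"
  defines "S \<equiv> \<Sum>t<T. packet_fail_prob t \<rho> lam \<kappa>"
  shows "sec_throughput T \<alpha> \<rho> lam \<kappa> =
    ((1 - \<alpha>) * \<kappa> 0 + \<alpha> / ((1 - \<rho>) * lam) * ((1 - \<rho>) * S + packet_fail_prob T \<rho> lam \<kappa> - 1)) /
    (1 - \<alpha> + \<alpha> * S)"
proof -
  have "(\<Sum>t=1..T. \<kappa> t * packet_fail_prob (t - 1) \<rho> lam \<kappa>) =
      ((1 - \<rho>) * S + packet_fail_prob T \<rho> lam \<kappa> - 1) / ((1 - \<rho>) * lam)"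
    using sum_secondary_weights[of \<rho> lam \<kappa> T] assms(2)
    unfolding S_def by (subst nonzero_eq_divide_eq) (auto simp: mult.commute)
  \<comment> \<open>\<open>S\<close> also counts the empty product at t = 0, a summand only for
    \<open>T \<ge> 1\<close>; this turns the 1 in the denominator into
    \<open>1 - \<alpha>\<close>.\<close>
  moreover have "S = 1 + (\<Sum>t=1..T - 1. packet_fail_prob t \<rho> lam \<kappa>)"
  proof -
    obtain n where n: "T = Suc n" using assms(1) by (cases T) auto
    show ?thesis
      unfolding S_def n
      by (simp add: lessThan_Suc_atMost atMost_atLeast0 sum.atLeast_Suc_atMost)
  qed
  ultimately show ?thesis
    unfolding sec_throughput_def packet_fail_prob_def[symmetric]
    by (simp add: distrib_left)
qed

lemma packet_fail_prob_pos:
  assumes "\<And>t. 1 \<le> t \<Longrightarrow> t \<le> n \<Longrightarrow> fail_prob \<rho> lam \<kappa> t > 0"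
  shows "packet_fail_prob n \<rho> lam \<kappa> > 0"
  unfolding packet_fail_prob_def using assms by (intro prod_pos) auto

lemma packet_fail_prob_lt_1:
  assumes "\<And>t. 1 \<le> t \<Longrightarrow> t \<le> n \<Longrightarrow> 0 < fail_prob \<rho> lam \<kappa> t \<and> fail_prob \<rho> lam \<kappa> t \<le> 1"
    and "1 \<le> i" "i \<le> n" "fail_prob \<rho> lam \<kappa> i < 1"
  shows "packet_fail_prob n \<rho> lam \<kappa> < 1"
proof -
  have "packet_fail_prob n \<rho> lam \<kappa> =
      fail_prob \<rho> lam \<kappa> i * (\<Prod>t\<in>{1..n} - {i}. fail_prob \<rho> lam \<kappa> t)"
    unfolding packet_fail_prob_def using assms by (intro prod.remove) auto
  also have "\<dots> \<le> fail_prob \<rho> lam \<kappa> i * 1"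
    using assms by (intro mult_left_mono prod_le_1) (auto intro: less_imp_le)
  finally show ?thesis using assms(4) by simp
qed

text \<open>For n < i neither changed factor occurs, for n = i only the scaled one, and for n > i
  both, so that \<open>s\<close> cancels. The products start at index 1, hence
  \<open>1 \<le> i\<close>.\<close>

lemma packet_fail_prob_exchange:
  assumes "1 \<le> i" "s \<noteq> 0"
    and "fail_prob \<rho> lam \<kappa>' i = s * fail_prob \<rho> lam \<kappa> i"
    and "fail_prob \<rho> lam \<kappa>' (Suc i) = fail_prob \<rho> lam \<kappa> (Suc i) / s"
    and "\<And>t. t \<noteq> i \<Longrightarrow> t \<noteq> Suc i \<Longrightarrow> fail_prob \<rho> lam \<kappa>' t = fail_prob \<rho> lam \<kappa> t"
  shows "packet_fail_prob n \<rho> lam \<kappa>' = (if n = i then s else 1) * packet_fail_prob n \<rho> lam \<kappa>"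
proof (induction n)
  case (Suc n)
  consider "Suc n = i" | "n = i" | "Suc n \<noteq> i" "n \<noteq> i" by auto
  then show ?case
    by cases (use Suc assms in auto)
qed (use assms(1) in auto)

text \<open>After cross-multiplication the difference of the two sides is
  \<open>(b * e - a * d) * (y - x)\<close>.\<close>

lemma linear_fractional_less:
  fixes a b d e x y :: real
  assumes "a * d < b * e" "x < y" "0 < e + d * x" "0 < e + d * y"
  shows "(a + b * x) / (e + d * x) < (a + b * y) / (e + d * y)"
proof -
  have "0 < (b * e - a * d) * (y - x)" using assms by (intro mult_pos_pos) auto
  then show ?thesis using assms by (simp add: divide_simps algebra_simps)
qed

text \<open>The value at state 0 enters no failure product, so raising it to 1 preserves feasibility
  and the denominator, while the numerator grows with slope \<open>1 - \<alpha>\<close>.\<close>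

lemma optimal_policy_idle:
  assumes "T \<ge> 1" "0 < \<alpha>" "\<alpha> < 1" "0 < \<rho>" "\<rho> < 1" "0 < lam"
    and opt: "optimal_policy T \<alpha> \<rho> lam \<sigma> \<kappa>"
  shows "\<kappa> 0 = 1"
proof (rule ccontr)
  assume "\<kappa> 0 \<noteq> 1"
  define \<kappa>' where "\<kappa>' = \<kappa>(0 := 1)"
  have feas: "feasible T \<rho> lam \<sigma> \<kappa>"
    using opt by (simp add: optimal_policy_def is_arg_max_def)
  then have pol: "\<And>t. t \<le> T \<Longrightarrow> 0 \<le> \<kappa> t \<and> \<kappa> t \<le> 1"
    by (auto simp: feasible_def policies_def)
  have lt: "\<kappa> 0 < 1" using pol[of 0] \<open>\<kappa> 0 \<noteq> 1\<close> by auto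
  have P_eq: "packet_fail_prob n \<rho> lam \<kappa>' = packet_fail_prob n \<rho> lam \<kappa>" for n
    by (induction n) (auto simp: \<kappa>'_def fail_prob_def)
  have feas': "feasible T \<rho> lam \<sigma> \<kappa>'"
    using feas P_eq by (auto simp: feasible_def policies_def \<kappa>'_def)
  define S where "S = (\<Sum>t<T. packet_fail_prob t \<rho> lam \<kappa>)"
  have "packet_fail_prob t \<rho> lam \<kappa> > 0" if "t < T" for t
  proof (rule packet_fail_prob_pos)
    fix u assume "1 \<le> u" "u \<le> t"
    with pol[of u] that have "0 \<le> (1 - \<rho>) * lam * \<kappa> u" using assms by simp
    then show "fail_prob \<rho> lam \<kappa> u > 0" using assms by (simp add: fail_prob_def)
  qed
  then have "0 \<le> S" unfolding S_def by (intro sum_nonneg) (simp add: less_imp_le)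
  then have "0 < 1 - \<alpha> + \<alpha> * S" using assms by (simp add: add_pos_nonneg)
  moreover have "(1 - \<alpha>) * \<kappa> 0 < (1 - \<alpha>) * \<kappa>' 0" using lt assms by (simp add: \<kappa>'_def)
  ultimately have "sec_throughput T \<alpha> \<rho> lam \<kappa> < sec_throughput T \<alpha> \<rho> lam \<kappa>'"
    using assms
    by (simp add: sec_throughput_eq P_eq S_def[symmetric] del: fun_upd_apply)
       (simp add: divide_strict_right_mono)
  then show False using opt feas' by (auto simp: optimal_policy_def is_arg_max_def)
qed

lemma optimal_policy_adjacent:
  assumes "0 < \<alpha>" "\<alpha> < 1" "0 < \<rho>" "\<rho> < 1" "0 < lam" "lam \<le> 1"
    and opt: "optimal_policy T \<alpha> \<rho> lam \<sigma> \<kappa>"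
    and i: "1 \<le> i" "Suc i \<le> T" "\<kappa> i < 1"
  shows "\<kappa> (Suc i) = 0"
proof (rule ccontr)
  assume "\<kappa> (Suc i) \<noteq> 0"
  define c where "c = (1 - \<rho>) * lam"
  have c: "0 < c" "c \<le> 1 - \<rho>"
    using assms mult_left_mono[of lam 1 "1 - \<rho>"] by (auto simp: c_def)
  have fail: "fail_prob \<rho> lam k t = \<rho> + c * k t" for k t
    by (simp add: fail_prob_def c_def)
  have feas: "feasible T \<rho> lam \<sigma> \<kappa>"
    using opt by (simp add: optimal_policy_def is_arg_max_def)
  then have pol: "\<And>t. t \<le> T \<Longrightarrow> 0 \<le> \<kappa> t \<and> \<kappa> t \<le> 1"
    by (auto simp: feasible_def policies_def)
  let ?r = "fail_prob \<rho> lam \<kappa>"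
  have r: "\<rho> \<le> ?r t \<and> ?r t \<le> \<rho> + c" if "t \<le> T" for t
    using pol[OF that] c mult_left_mono[of "\<kappa> t" 1 c] by (auto simp: fail)
  have ri: "?r i < \<rho> + c" using i c by (simp add: fail)
  have rSi: "\<rho> < ?r (Suc i)"
    using \<open>\<kappa> (Suc i) \<noteq> 0\<close> pol[OF i(2)] c by (auto simp: fail)
  have rpos: "0 < ?r i" using r[of i] i assms by linarith
  \<comment> \<open>The largest factor that keeps both modified failure probabilities in the
    attainable range from \<open>\<rho>\<close> to \<open>\<rho> + c\<close>. It exceeds 1 because
    \<open>\<kappa> i < 1\<close> and \<open>\<kappa> (Suc i) > 0\<close>.\<close>
  define s where "s = min ((\<rho> + c) / ?r i) (?r (Suc i) / \<rho>)"
  have s: "1 < s" using ri rSi rpos assms by (simp add: s_def)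
  have "s \<le> (\<rho> + c) / ?r i" by (simp add: s_def)
  then have s1: "s * ?r i \<le> \<rho> + c"
    using rpos by (simp add: pos_le_divide_eq)
  have "s \<le> ?r (Suc i) / \<rho>" by (simp add: s_def)
  then have s2: "\<rho> \<le> ?r (Suc i) / s"
    using assms s by (simp add: pos_le_divide_eq mult.commute)
  have s3: "\<rho> \<le> s * ?r i" using r[of i] i s rpos mult_right_mono[of 1 s "?r i"] by linarith
  have "?r (Suc i) / s \<le> ?r (Suc i) / 1"
    using rSi assms s by (intro divide_left_mono) auto
  then have s4: "?r (Suc i) / s \<le> \<rho> + c" using r[OF i(2)] by simp
  \<comment> \<open>The new policy values come from inverting the affine map x \<mapsto>
    \<open>\<rho> + c * x\<close> at the desired failure probabilities.\<close>
  define \<kappa>' where "\<kappa>' = \<kappa>(i := (s * ?r i - \<rho>) / c, Suc i := (?r (Suc i) / s - \<rho>) / c)"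
  have P': "packet_fail_prob n \<rho> lam \<kappa>' = (if n = i then s else 1) * packet_fail_prob n \<rho> lam \<kappa>"
    for n
    using i s c by (intro packet_fail_prob_exchange) (auto simp: fail \<kappa>'_def)
  have PT: "packet_fail_prob T \<rho> lam \<kappa>' = packet_fail_prob T \<rho> lam \<kappa>"
    using P'[of T] i by simp
  have "(x - \<rho>) / c \<in> {0..1}" if "\<rho> \<le> x" "x \<le> \<rho> + c" for x
    using that c by (simp add: divide_simps)
  with s1 s2 s3 s4 pol have "\<kappa>' \<in> policies T"
    unfolding policies_def \<kappa>'_def by (simp add: Pi_iff)
  then have feas': "feasible T \<rho> lam \<sigma> \<kappa>'"
    using feas PT by (simp add: feasible_def)
  define S S' p where "S = (\<Sum>t<T. packet_fail_prob t \<rho> lam \<kappa>)"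
    and "S' = (\<Sum>t<T. packet_fail_prob t \<rho> lam \<kappa>')"
    and "p = packet_fail_prob T \<rho> lam \<kappa>"
  have pos: "packet_fail_prob t \<rho> lam \<kappa> > 0" if "t < T" for t
    using r that assms by (intro packet_fail_prob_pos) (meson le_trans less_le_trans less_imp_le)
  \<comment> \<open>Only the summand at \<open>i\<close> changes, growing by the factor
    \<open>s\<close>; it is present because \<open>Suc i \<le> T\<close>.\<close>
  have "S < S'"
    unfolding S_def S'_def
  proof (rule sum_strict_mono_ex1)
    show "\<forall>t\<in>{..<T}. packet_fail_prob t \<rho> lam \<kappa> \<le> packet_fail_prob t \<rho> lam \<kappa>'"
      using pos s by (auto simp: P')
    show "\<exists>t\<in>{..<T}. packet_fail_prob t \<rho> lam \<kappa> < packet_fail_prob t \<rho> lam \<kappa>'"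
      using pos s i by (intro bexI[of _ i]) (auto simp: P')
  qed simp
  have "0 \<le> S" unfolding S_def using pos by (intro sum_nonneg) (simp add: less_imp_le)
  \<comment> \<open>The i-th factor is strictly below \<open>\<rho> + c \<le> 1\<close>.\<close>
  have "p < 1"
    unfolding p_def
  proof (rule packet_fail_prob_lt_1[where i = i])
    show "0 < ?r t \<and> ?r t \<le> 1" if "1 \<le> t" "t \<le> T" for t
      using r[OF that(2)] c assms by linarith
  qed (use i ri c in auto)
  have k0: "\<kappa>' 0 = \<kappa> 0" using i by (simp add: \<kappa>'_def)
  define q where "q = \<alpha> / c"
  have q: "0 < q" "\<alpha> \<le> q * (1 - \<rho>)"
    using c assms by (auto simp: q_def divide_simps)
  define a b where "a = (1 - \<alpha>) * \<kappa> 0 - q * (1 - p)" and "b = q * (1 - \<rho>)"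
  \<comment> \<open>This is the monotonicity condition of \<open>linear_fractional_less\<close>. It
    combines \<open>a < 1 - \<alpha>\<close>, strict because \<open>p < 1\<close>, with
    \<open>\<alpha> \<le> b\<close>, which comes from \<open>c \<le> 1 - \<rho>\<close>.\<close>
  have "a * \<alpha> < b * (1 - \<alpha>)"
  proof -
    have "a < (1 - \<alpha>) * \<kappa> 0" unfolding a_def using \<open>p < 1\<close> q by simp
    also have "\<dots> \<le> (1 - \<alpha>) * 1" using pol[of 0] assms by (intro mult_left_mono) auto
    finally have "a < 1 - \<alpha>" by simp
    then have "a * \<alpha> < (1 - \<alpha>) * \<alpha>" using assms by (intro mult_strict_right_mono) auto
    moreover have "\<alpha> * (1 - \<alpha>) \<le> b * (1 - \<alpha>)"
      unfolding b_def using q assms by (intro mult_right_mono) auto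
    ultimately show ?thesis by (simp add: mult.commute)
  qed
  then have less: "(a + b * S) / (1 - \<alpha> + \<alpha> * S) < (a + b * S') / (1 - \<alpha> + \<alpha> * S')"
    using \<open>S < S'\<close> \<open>0 \<le> S\<close> assms
    by (intro linear_fractional_less) (auto intro!: add_pos_nonneg mult_nonneg_nonneg)
  have num: "(1 - \<alpha>) * \<kappa> 0 + q * ((1 - \<rho>) * x + p - 1) = a + b * x" for x
    by (simp add: a_def b_def algebra_simps)
  have "T \<ge> 1" "(1 - \<rho>) * lam \<noteq> 0" using i c by (auto simp: c_def)
  note eqs = sec_throughput_eq[OF this, of \<alpha>, folded c_def, folded q_def]
  have "sec_throughput T \<alpha> \<rho> lam \<kappa> = (a + b * S) / (1 - \<alpha> + \<alpha> * S)"
    using eqs[of \<kappa>] by (simp only: S_def[symmetric] p_def[symmetric] num)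
  moreover have "sec_throughput T \<alpha> \<rho> lam \<kappa>' = (a + b * S') / (1 - \<alpha> + \<alpha> * S')"
    using eqs[of \<kappa>'] by (simp only: S'_def[symmetric] PT k0 p_def[symmetric] num)
  ultimately show False using less opt feas' by (auto simp: optimal_policy_def is_arg_max_def)
qed

theorem mainTheorem2:
  fixes T :: nat and \<alpha> \<rho> lam \<sigma> :: real and \<kappa> :: "nat \<Rightarrow> real"
  assumes "T \<ge> 1"
    and "0 < \<alpha>" and "\<alpha> < 1"
    and "0 < \<rho>" and "\<rho> < 1"
    and "0 < lam" and "lam \<le> 1"
    and "\<sigma> \<ge> 0"
    and "optimal_policy T \<alpha> \<rho> lam \<sigma> \<kappa>"
  shows "\<exists>(N1::nat) (N0::nat). N1 + 1 + N0 = T + 1 \<and>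
           (\<exists>\<kappa>N\<in>{0..1::real}.
              (\<forall>\<theta><N1. \<kappa> \<theta> = 1) \<and>
              \<kappa> N1 = \<kappa>N \<and>
              (\<forall>\<theta>. N1 < \<theta> \<and> \<theta> \<le> T \<longrightarrow> \<kappa> \<theta> = 0))"
proof -
  have pol: "0 \<le> \<kappa> t \<and> \<kappa> t \<le> 1" if "t \<le> T" for t
    using assms(9) that
    by (auto simp: optimal_policy_def is_arg_max_def feasible_def policies_def)
  have idle: "\<kappa> 0 = 1" using optimal_policy_idle assms by blast
  \<comment> \<open>The exchange covers t \<ge> 1; at t = 0 the premise contradicts
    \<open>\<kappa> 0 = 1\<close>.\<close>
  have step: "\<kappa> (Suc t) = 0" if "Suc t \<le> T" "\<kappa> t < 1" for t
    using optimal_policy_adjacent[OF assms(2-7) assms(9), of t] that idle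
    by (cases "t = 0") auto
  \<comment> \<open>The first state with value below 1. The alternative \<open>n = T\<close>
    guarantees existence and \<open>N \<le> T\<close>; if all earlier values are 1, the last state
    serves as the threshold.\<close>
  define N where "N = (LEAST n. n = T \<or> \<kappa> n < 1)"
  have N: "N = T \<or> \<kappa> N < 1" unfolding N_def by (rule LeastI[of _ T]) simp
  have NT: "N \<le> T" unfolding N_def by (rule Least_le) simp
  have ones: "\<kappa> t = 1" if "t < N" for t
    using not_less_Least[of t "\<lambda>n. n = T \<or> \<kappa> n < 1"] that pol[of t] NT by (auto simp: N_def)
  \<comment> \<open>Zeros propagate upwards: the first follows from \<open>\<kappa> N < 1\<close>,
    which holds as N < T here, and each later one from its predecessor being 0.\<close>
  have zeros: "t \<le> T \<Longrightarrow> \<kappa> t = 0" if "N < t" for t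
    using that
  proof (induction t)
    case (Suc t)
    then have "\<kappa> t < 1" using N by (cases "t = N") auto
    then show ?case using step Suc.prems by blast
  qed simp
  show ?thesis
    using NT pol[OF NT] ones zeros by (intro exI[of _ N] exI[of _ "T - N"]) auto
qed

end
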